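(* Let $k\ge2$ be a natural number. Then $$\mathcal{R}_1(k+1,k)\le R^{\,{\mathcal{R}_1(k+1,\,k-1)\brack k-1}}(k+1,k).$$
   Context: $T_n=n(n+1)/2$, $T_0=0$. A finite set $X\subseteq\mathbb{N}$ with $|X|=T_n$, enumerated $x_1<\dots<x_{T_n}$, has $i$-th level $\{x_{T_{i-1}+1},\dots,x_{T_i}\}$ for $1\le i\le n$; $\triangle_n$ is the set of all such sets. For such sets, $X\le Y$ means $X\subseteq Y$ and every level of $X$ is contained in a single level of $Y$, distinct levels of $X$ being contained in distinct levels of $Y$; $\triangle_k(B)=\{Z\in\triangle_k:Z\le B\}$. For natural numbers $k\le p,q$, a completed game of Mines$_m(p,q,k)$ is a partition $\triangle_k(B)=X\sqcup Y$ with $B\in\triangle_m$; it is a win for player one if there is $Z\in\triangle_p(B)$ with $\triangle_k(Z)\subseteq X$, a win for player two if there is $Z\in\triangle_q(B)$ with $\triangle_k(Z)\subseteq Y$, and a draw otherwise. $\mathcal{R}_1(p,q,k)$ is the least $m\ge\max(p,q)$ such that no completed game of Mines$_m(p,q,k)$ is a draw, and $\mathcal{R}_1(n,k)=\mathcal{R}_1(n,n,k)$. The numbers ${n\brack k}$ are defined by ${n\brack0}={n\brack n}=1$ and ${n\brack k}={n-1\brack k}+\binom nk{n-1\brack k-1}$ for $0<k<n$. $R(n,k)$ is the least $N$ such that every 2-coloring of the $k$-element subsets of an $N$-element set admits an $n$-element subset all of whose $k$-element subsets have the same color; $R^1(n,k)=R(n,k)$ and $R^{l+1}(n,k)=R(R^{l}(n,k),k)$.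 *)

theory Defs
  imports "HOL-Library.Ramsey" "HOL-Library.Nat_Bijection"
begin

definition triangles :: "nat \<Rightarrow> nat set set" where
  "triangles n = {X. finite X \<and> card X = triangle n}"

text \<open>
  Writing \<open>x\<^sub>1 < x\<^sub>2 < \<dots>\<close> for the elements of \<open>X\<close>, the \<open>i\<close>-th level of \<open>X\<close> (\<open>i \<ge> 1\<close>) consists of the
  \<open>x\<^sub>j\<close> with \<open>triangle (i - 1) + 1 \<le> j \<le> triangle i\<close>. List positions start at 0, so \<open>x\<^sub>j\<close> is found at
  position \<open>j - 1\<close>.
\<close>
definition level :: "nat set \<Rightarrow> nat \<Rightarrow> nat set" where
  "level X i = (!) (sorted_list_of_set X) ` {triangle (i - 1)..<triangle i}"

text \<open>
  For \<open>X \<in> triangles n\<close> the index range below is \<open>1 \<le> i \<le> n\<close>, as \<open>triangle\<close> is strictly increasing.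
\<close>
definition levels :: "nat set \<Rightarrow> nat set set" where
  "levels X = level X ` {i. 1 \<le> i \<and> triangle i \<le> card X}"

definition tri_le :: "nat set \<Rightarrow> nat set \<Rightarrow> bool"  (infix \<open>\<preceq>\<^sub>\<triangle>\<close> 50) where
  "X \<preceq>\<^sub>\<triangle> Y \<longleftrightarrow>
     X \<subseteq> Y \<and>
     (\<exists>f. inj_on f (levels X) \<and> (\<forall>L \<in> levels X. f L \<in> levels Y \<and> L \<subseteq> f L))"

definition triangles_below :: "nat \<Rightarrow> nat set \<Rightarrow> nat set set" where
  "triangles_below k B = {Z \<in> triangles k. Z \<preceq>\<^sub>\<triangle> B}"

definition completed_game :: "nat \<Rightarrow> nat \<Rightarrow> nat set \<Rightarrow> nat set set \<Rightarrow> nat set set \<Rightarrow> bool" where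
  "completed_game m k B X Y \<longleftrightarrow>
     B \<in> triangles m \<and> X \<union> Y = triangles_below k B \<and> X \<inter> Y = {}"

text \<open>
  \<open>player_wins p k B X\<close> is used for either player: \<open>X\<close> is the part of \<open>triangles_below k B\<close> owned by
  that player, and \<open>p\<close> is the size the player aims for.
\<close>
definition player_wins :: "nat \<Rightarrow> nat \<Rightarrow> nat set \<Rightarrow> nat set set \<Rightarrow> bool" where
  "player_wins p k B X \<longleftrightarrow> (\<exists>Z \<in> triangles_below p B. triangles_below k Z \<subseteq> X)"

definition draw :: "nat \<Rightarrow> nat \<Rightarrow> nat \<Rightarrow> nat set \<Rightarrow> nat set set \<Rightarrow> nat set set \<Rightarrow> bool" where
  "draw p q k B X Y \<longleftrightarrow> \<not> player_wins p k B X \<and> \<not> player_wins q k B Y"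

definition mines_number :: "nat \<Rightarrow> nat \<Rightarrow> nat \<Rightarrow> nat" where
  "mines_number p q k =
     (LEAST m. max p q \<le> m \<and> (\<forall>B X Y. completed_game m k B X Y \<longrightarrow> \<not> draw p q k B X Y))"

definition mines_diag :: "nat \<Rightarrow> nat \<Rightarrow> nat" where
  "mines_diag n k = mines_number n n k"

text \<open>
  The intended range is \<open>k \<le> n\<close>; by convention the value is 0 for \<open>k > n\<close>.
\<close>
fun tri_binomial :: "nat \<Rightarrow> nat \<Rightarrow> nat" where
  "tri_binomial n 0 = 1"
| "tri_binomial 0 (Suc k) = 0"
| "tri_binomial (Suc n) (Suc k) =
     (if k = n then 1
      else tri_binomial n (Suc k) + (Suc n choose Suc k) * tri_binomial n k)"

lemma tri_binomial_same: "tri_binomial n n = 1"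
  by (cases n) simp_all

lemma tri_binomial_rec:
  assumes "0 < k" "k < n"
  shows "tri_binomial n k = tri_binomial (n - 1) k + (n choose k) * tri_binomial (n - 1) (k - 1)"
  using assms by (cases n; cases k) simp_all

text \<open>
  \<open>partn_lst {..<N} [n, n] k\<close> says that every colouring of the \<open>k\<close>-subsets of \<open>{..<N}\<close> with the two
  colours 0 and 1 has an \<open>n\<close>-subset all of whose \<open>k\<close>-subsets have the same colour.
\<close>
definition ramsey_number :: "nat \<Rightarrow> nat \<Rightarrow> nat" where
  "ramsey_number n k = (LEAST N. partn_lst {..<N} [n, n] k)"

text \<open>
  The first argument is iterated: \<open>ramsey_iter 1 n k = ramsey_number n k\<close> and
  \<open>ramsey_iter (Suc l) n k = ramsey_number (ramsey_iter l n k) k\<close>.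
\<close>
definition ramsey_iter :: "nat \<Rightarrow> nat \<Rightarrow> nat \<Rightarrow> nat" where
  "ramsey_iter l n k = ((\<lambda>N. ramsey_number N k) ^^ l) n"

end

theory Submission
  imports Defs "HOL-Library.Sublist"
begin

text \<open>
  Let \<open>M\<close> be the number for \<open>k - 1\<close>, and colour the triangles of height \<open>k\<close> below a triangle with
  \<open>N\<close> levels, where \<open>N\<close> is the claimed bound; one checks that \<open>N > M\<close>. Each of the at most
  \<open>tri_binomial M (k - 1)\<close> triangles \<open>s\<close> of height \<open>k - 1\<close> below the first \<open>M\<close> levels induces a
  colouring of the \<open>k\<close>-subsets \<open>t\<close> of the last level, namely the colour of \<open>s \<union> t\<close>. Applying
  Ramsey's theorem once for each \<open>s\<close> leaves a set \<open>D\<close> of \<open>k + 1\<close> points of the last level on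
  which the colour of \<open>s \<union> t\<close> depends on \<open>s\<close> only. By the choice of \<open>M\<close> there is a triangle \<open>Z\<close>
  of height \<open>k + 1\<close> below the first \<open>M\<close> levels such that this colour is the same, say \<open>a\<close>, for all
  \<open>s\<close> below \<open>Z\<close>. If some triangle \<open>X\<close> of height \<open>k\<close> below \<open>Z\<close> has colour \<open>a\<close>, then \<open>X \<union> D\<close> is
  homogeneous of colour \<open>a\<close>; otherwise \<open>Z\<close> is homogeneous of the other colour.

  For \<open>M\<close> to have its defining property one needs that the least number defining it exists. This
  is shown by induction on \<open>k\<close>: thinning out levels and points of a large triangle by Ramsey's
  theorem makes the colour independent of the top level, which reduces \<open>k + 1\<close> to \<open>k\<close>.
\<close>

subsection \<open>Iterated Ramsey numbers\<close>

lemma ramsey_number_partn: "partn_lst {..<ramsey_number n k} [n, n] k"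
  unfolding ramsey_number_def by (rule LeastI_ex) (rule ramsey_full)

text \<open>Transfers the number to Boolean colourings of any finite set with enough points, by
  pulling the colouring back along an enumeration \<open>h\<close>.\<close>

lemma ramsey_number_homogeneous:
  fixes c :: "'a set \<Rightarrow> bool"
  assumes "ramsey_number n k \<le> card C" "finite C"
  obtains D b where "D \<subseteq> C" "card D = n" "finite D" "\<And>t. t \<in> [D]\<^bsup>k\<^esup> \<Longrightarrow> c t = b"
proof -
  obtain h where h: "inj_on h {..<card C}" "h ` {..<card C} = C"
    using ex_bij_betw_nat_finite[OF \<open>finite C\<close>] by (metis atLeast0LessThan bij_betw_def)
  define f where "f = (\<lambda>S. if c (h ` S) then 1 else (0::nat))"
  have "partn_lst {..<card C} [n, n] k"
    using ramsey_number_partn assms(1) by (rule partn_lst_greater_resource)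
  moreover have "f \<in> nsets {..<card C} k \<rightarrow> {..<length [n, n]}"
    by (auto simp: f_def)
  ultimately obtain i H where i: "i < length [n, n]"
    and H: "H \<in> nsets {..<card C} ([n, n] ! i)" and sub: "f ` nsets H k \<subseteq> {i}"
    using partn_lstE[OF _ _ refl] by blast
  from i have i: "i < 2" by simp
  from H i have H: "H \<subseteq> {..<card C}" "finite H" "card H = n"
    by (auto simp: nsets_def less_2_cases_iff)
  show thesis
  proof
    show "h ` H \<subseteq> C" using h H by blast
    have inj: "inj_on h H" using h H inj_on_subset by blast
    then show "card (h ` H) = n" using H by (simp add: card_image)
    show "finite (h ` H)" using H by simp
    show "c t = (i = 1)" if t: "t \<in> [h ` H]\<^bsup>k\<^esup>" for t
    proof -
      obtain S where S: "S \<in> [H]\<^bsup>k\<^esup>" "t = h ` S"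
        using nset_image_obtains[OF t inj] .
      then have "f S = i" using sub by blast
      then show ?thesis using S i by (auto simp: f_def split: if_splits)
    qed
  qed
qed

text \<open>With only \<open>n\<close> points the whole set is the only candidate, and colouring a
  \<open>k\<close>-subset by whether it contains 0 defeats it.\<close>

lemma ramsey_number_greater:
  assumes "1 \<le> k" "k < n"
  shows "n < ramsey_number n k"
proof (rule ccontr)
  assume "\<not> ?thesis"
  then have "partn_lst {..<n} [n, n] k"
    using ramsey_number_partn partn_lst_greater_resource by (meson linorder_not_less)
  moreover define f where "f S = (if 0 \<in> S then 1 else (0::nat))" for S :: "nat set"
  have "f \<in> nsets {..<n} k \<rightarrow> {..<length [n, n]}"
    by (auto simp: f_def)
  ultimately obtain i H where i: "i < length [n, n]"
    and H: "H \<in> nsets {..<n} ([n, n] ! i)" and sub: "f ` nsets H k \<subseteq> {i}"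
    using partn_lstE[OF _ _ refl] by blast
  from i have "i < 2" by simp
  with H have "H \<in> nsets {..<n} n"
    by (auto simp: less_2_cases_iff)
  then have H: "H = {..<n}" by simp
  have "{..<k} \<in> nsets H k" "{1..<Suc k} \<in> nsets H k"
    using assms by (auto simp: H nsets_def)
  then have "f {..<k} = f {1..<Suc k}"
    using sub by (metis image_subset_iff singletonD)
  then show False using assms by (auto simp: f_def split: if_splits)
qed

lemma ramsey_iter_0 [simp]: "ramsey_iter 0 n k = n"
  by (simp add: ramsey_iter_def)

lemma ramsey_iter_Suc [simp]:
  "ramsey_iter (Suc l) n k = ramsey_number (ramsey_iter l n k) k"
  by (simp add: ramsey_iter_def)

lemma ramsey_iter_ge:
  assumes "1 \<le> k" "k < n"
  shows "n + l \<le> ramsey_iter l n k"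
proof (induction l)
  case (Suc l)
  then show ?case
    using ramsey_number_greater[of k "ramsey_iter l n k"] assms by simp
qed simp

text \<open>The elements of \<open>S\<close> are treated one at a time. The outermost Ramsey number
  makes \<open>c x\<close> constant on a subset of size \<open>ramsey_iter l n k\<close>, and
  constancy survives all later shrinking.\<close>

lemma ramsey_iter_homogeneous:
  fixes c :: "'b \<Rightarrow> 'a set \<Rightarrow> bool"
  assumes "finite S" "card S \<le> l" "finite C" "ramsey_iter l n k \<le> card C"
  obtains D \<tau> where "D \<subseteq> C" "card D = n" "finite D"
    "\<And>s t. s \<in> S \<Longrightarrow> t \<in> [D]\<^bsup>k\<^esup> \<Longrightarrow> c s t = \<tau> s"
  using assms
proof (induction l arbitrary: S C thesis)
  case 0
  then have "S = {}" by simp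
  moreover obtain D where "D \<subseteq> C" "card D = n" "finite D"
    using obtain_subset_with_card_n[of n C] 0 by auto
  ultimately show ?case using 0(1) by blast
next
  case (Suc l)
  \<comment> \<open>For empty \<open>S\<close> the point \<open>x\<close> is arbitrary and one
    application of Ramsey's theorem is spent on it; hence an inclusion instead of an
    equality.\<close>
  obtain x S' where S': "finite S'" "card S' \<le> l" "S \<subseteq> insert x S'"
  proof (cases "S = {}")
    case False
    then obtain x where "x \<in> S" by blast
    then show ?thesis using that[of "S - {x}" x] Suc.prems(2,3) by (simp add: insert_absorb)
  qed (use that[of "{}"] in auto)
  obtain C' b where C': "C' \<subseteq> C" "card C' = ramsey_iter l n k" "finite C'"
    and b: "\<And>t. t \<in> [C']\<^bsup>k\<^esup> \<Longrightarrow> c x t = b"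
    using ramsey_number_homogeneous[of "ramsey_iter l n k" k C "c x"] Suc.prems
    by (metis ramsey_iter_Suc)
  obtain D \<tau> where D: "D \<subseteq> C'" "card D = n" "finite D"
    and \<tau>: "\<And>s t. s \<in> S' \<Longrightarrow> t \<in> [D]\<^bsup>k\<^esup> \<Longrightarrow> c s t = \<tau> s"
    using Suc.IH[of C' S'] S' C' by auto
  have "c s t = (\<tau>(x := b)) s" if "s \<in> S" "t \<in> [D]\<^bsup>k\<^esup>" for s t
    using that S' b \<tau> nsets_mono[OF D(1)] by (metis fun_upd_apply insertE subsetD)
  with Suc.prems(1)[of D "\<tau>(x := b)"] D C' show ?case by auto
qed

section \<open>Lower bounds for the triangular binomial coefficients\<close>

lemma tri_binomial_pos: "k \<le> n \<Longrightarrow> 1 \<le> tri_binomial n k"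
  by (induction n k rule: tri_binomial.induct) auto

text \<open>The second summand of the recursion is at least 1, so the value grows by at least 1 with
  each step from \<open>n = k\<close> on. This later yields \<open>M < N\<close>.\<close>

lemma tri_binomial_ge: "1 \<le> k \<Longrightarrow> k \<le> n \<Longrightarrow> n - k < tri_binomial n k"
proof (induction n arbitrary: k)
  case (Suc n)
  show ?case
  proof (cases "k = Suc n")
    case False
    then have k: "1 \<le> k" "k \<le> n" using Suc.prems by auto
    have "1 \<le> (Suc n choose k) * tri_binomial (Suc n - 1) (k - 1)"
      using tri_binomial_pos[of "k - 1" n] k by (simp add: Suc_leI)
    then show ?thesis
      using Suc.IH[of k] tri_binomial_rec[of k "Suc n"] k unfolding diff_Suc_1 by linarith
  qed simp
qed simp

subsection \<open>Staircases\<close>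

text \<open>
  A triangle is encoded by the list of its levels, the largest level first. Under this encoding the
  relation of the game becomes the embedding order on lists induced by inclusion.
\<close>
definition staircase :: "nat \<Rightarrow> 'a set list \<Rightarrow> bool" where
  "staircase k Xs \<longleftrightarrow> map card Xs = rev [1..<Suc k]"

lemma staircase_0 [simp]: "staircase 0 Xs \<longleftrightarrow> Xs = []"
  by (simp add: staircase_def)

lemma staircase_Nil [simp]: "staircase k [] \<longleftrightarrow> k = 0"
  by (simp add: staircase_def)

lemma staircase_Cons:
  "staircase k (x # Xs) \<longleftrightarrow> k > 0 \<and> card x = k \<and> staircase (k - 1) Xs"
  by (cases k) (auto simp: staircase_def)

lemma staircase_length: "staircase k Xs \<Longrightarrow> length Xs = k"
  by (auto simp: staircase_def dest: arg_cong[where f = length])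

lemma staircase_drop: "staircase k Xs \<Longrightarrow> staircase (k - i) (drop i Xs)"
proof (induction i arbitrary: k Xs)
  case (Suc i)
  show ?case
  proof (cases Xs)
    case (Cons x Ys)
    then show ?thesis using Suc.IH[of "k - 1" Ys] Suc.prems by (simp add: staircase_Cons)
  qed (use Suc.prems in auto)
qed simp

lemma staircase_take_card: "staircase k Xs \<Longrightarrow> x \<in> set (take i Xs) \<Longrightarrow> k - i < card x"
proof (induction i arbitrary: k Xs)
  case (Suc i)
  then show ?case by (cases Xs) (force simp: staircase_Cons)+
qed simp

lemma staircase_mem: "staircase k Xs \<Longrightarrow> x \<in> set Xs \<Longrightarrow> finite x \<and> x \<noteq> {}"
  by (induction Xs arbitrary: k) (auto simp: staircase_Cons card_gt_0_iff)

text \<open>For a descending staircase \<open>Bs\<close> these lists encode the triangles of height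
  \<open>k\<close> below the one encoded by \<open>Bs\<close>. Levels need not be ordered here, so
  the Ramsey argument works for arbitrary lists of sets.\<close>

definition picks :: "nat \<Rightarrow> 'a set list \<Rightarrow> 'a set list set" where
  "picks k Bs = {Xs. list_emb (\<subseteq>) Xs Bs \<and> staircase k Xs}"

lemma list_emb_subset_trans:
  "list_emb (\<subseteq>) Xs Ys \<Longrightarrow> list_emb (\<subseteq>) Ys Zs \<Longrightarrow> list_emb (\<subseteq>) Xs (Zs :: 'a set list)"
  by (rule list_emb_trans) auto

lemma picks_mono: "list_emb (\<subseteq>) Xs Ys \<Longrightarrow> picks k Xs \<subseteq> picks k Ys"
  by (auto simp: picks_def intro: list_emb_subset_trans)

lemma picks_0 [simp]: "picks 0 Bs = {[]}"
  by (auto simp: picks_def)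

lemma picks_Nil [simp]: "picks (Suc k) [] = {}"
  by (auto simp: picks_def dest: list_emb_Nil2)

lemma list_emb_Cons_Cons:
  "list_emb P (x # xs) (y # ys) \<longleftrightarrow> P x y \<and> list_emb P xs ys \<or> list_emb P (x # xs) ys"
  by (auto elim: list_emb.cases)

text \<open>A Pascal-type recursion: the first level \<open>b\<close> is either skipped or supplies
  the top level. It mirrors the recursion of \<open>tri_binomial\<close> and drives both counting
  bounds.\<close>

lemma picks_Suc_Cons:
  "picks (Suc k) (b # Bs) =
     picks (Suc k) Bs \<union> (\<lambda>(t, s). t # s) ` ([b]\<^bsup>Suc k\<^esup> \<times> picks k Bs)"
proof (intro equalityI subsetI)
  fix Xs assume "Xs \<in> picks (Suc k) (b # Bs)"
  then show "Xs \<in> picks (Suc k) Bs \<union> (\<lambda>(t, s). t # s) ` ([b]\<^bsup>Suc k\<^esup> \<times> picks k Bs)"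
    by (cases Xs)
      (auto simp: picks_def staircase_Cons list_emb_Cons_Cons nsets_def image_iff
            intro: card_ge_0_finite)
qed (auto simp: picks_def staircase_Cons list_emb_Cons_Cons nsets_def)

lemma picks_ConsE:
  assumes "t # s \<in> picks (Suc k) (b # Bs)"
  obtains "t # s \<in> picks (Suc k) Bs" | "t \<in> [b]\<^bsup>Suc k\<^esup>" "s \<in> picks k Bs"
  using assms by (auto simp: picks_Suc_Cons)

lemma picks_tail: "t # s \<in> picks (Suc k) Bs \<Longrightarrow> s \<in> picks k Bs"
  by (auto simp: picks_def staircase_Cons dest!: list_emb_ConsD)

lemma picks_eq_singleton: "staircase k Bs \<Longrightarrow> picks k Bs \<subseteq> {Bs}"
proof (induction Bs arbitrary: k)
  case (Cons b Bs)
  then obtain j where k: "k = Suc j" "card b = Suc j" "staircase j Bs"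
    by (cases k) (auto simp: staircase_Cons)
  \<comment> \<open>Once \<open>b\<close> is skipped only \<open>j\<close> levels remain, too few
    for height \<open>Suc j\<close>.\<close>
  have "picks (Suc j) Bs = {}"
    using staircase_length[OF k(3)]
    by (auto simp: picks_def dest!: list_emb_length staircase_length)
  moreover have "[b]\<^bsup>Suc j\<^esup> \<subseteq> {b}"
    using k(2) by (auto simp: nsets_def) (metis card_subset_eq card_ge_0_finite zero_less_Suc)+
  ultimately show ?case using Cons.IH[OF k(3)] by (auto simp: k(1) picks_Suc_Cons)
qed (auto simp: picks_def)

lemma finite_picks: "(\<And>B. B \<in> set Bs \<Longrightarrow> finite B) \<Longrightarrow> finite (picks k Bs)"
proof (induction Bs arbitrary: k)
  case Nil
  then show ?case by (cases k) auto
next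
  case (Cons b Bs)
  then show ?case by (cases k) (auto simp: picks_Suc_Cons finite_imp_finite_nsets)
qed

lemma card_picks_Cons:
  assumes "\<And>B. B \<in> set (b # Bs) \<Longrightarrow> finite B"
  shows "card (picks (Suc k) (b # Bs)) \<le>
    card (picks (Suc k) Bs) + (card b choose Suc k) * card (picks k Bs)"
proof -
  have "card (picks (Suc k) (b # Bs)) \<le> card (picks (Suc k) Bs) +
      card ((\<lambda>(t, s). t # s) ` ([b]\<^bsup>Suc k\<^esup> \<times> picks k Bs))"
    unfolding picks_Suc_Cons by (rule card_Un_le)
  also have "card ((\<lambda>(t, s). t # s) ` ([b]\<^bsup>Suc k\<^esup> \<times> picks k Bs)) \<le>
      card ([b]\<^bsup>Suc k\<^esup> \<times> picks k Bs)"
    using assms by (intro card_image_le) (auto simp: finite_picks finite_imp_finite_nsets)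
  also have "\<dots> = (card b choose Suc k) * card (picks k Bs)"
    by (simp add: card_cartesian_product)
  finally show ?thesis by simp
qed

text \<open>Induction along \<open>picks_Suc_Cons\<close>; the boundary value 1 at
  \<open>k = n\<close> is \<open>picks_eq_singleton\<close>.\<close>

lemma card_picks_le: "staircase n Bs \<Longrightarrow> k \<le> n \<Longrightarrow> card (picks k Bs) \<le> tri_binomial n k"
proof (induction Bs arbitrary: n k)
  case (Cons b Bs)
  then obtain m where n: "n = Suc m" "card b = Suc m" "staircase m Bs"
    by (cases n) (auto simp: staircase_Cons)
  show ?case
  proof (cases "k = n")
    case True
    then have "card (picks k (b # Bs)) \<le> card {b # Bs}"
      using picks_eq_singleton Cons.prems by (intro card_mono) auto
    then show ?thesis using True by (simp add: tri_binomial_same)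
  next
    case False
    show ?thesis
    proof (cases k)
      case (Suc j)
      have "card (picks k (b # Bs)) \<le>
          card (picks (Suc j) Bs) + (Suc m choose Suc j) * card (picks j Bs)"
        unfolding Suc n(2)[symmetric]
        using staircase_mem[OF Cons.prems(1)] by (intro card_picks_Cons) blast
      then show ?thesis
        using Cons.IH[OF n(3), of j] Cons.IH[OF n(3), of "Suc j"] False Cons.prems(2) n(1) Suc
        by (auto intro: order.trans[OF _ add_mono[OF _ mult_le_mono2]])
    qed simp
  qed
qed simp

subsection \<open>The Ramsey theorem for staircases\<close>

text \<open>A crude count for levels of bounded size: each level is either dropped or replaced by
  one of its at most \<open>2 ^ v\<close> subsets.\<close>

lemma card_picks_le_power:
  assumes "\<And>B. B \<in> set Bs \<Longrightarrow> finite B \<and> card B \<le> v"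
  shows "card (picks k Bs) \<le> (1 + 2 ^ v) ^ length Bs"
  using assms
proof (induction Bs arbitrary: k)
  case Nil
  then show ?case by (cases k) auto
next
  case (Cons b Bs)
  show ?case
  proof (cases k)
    case (Suc j)
    have "card b choose Suc j = card ([b]\<^bsup>Suc j\<^esup>)" by simp
    also have "\<dots> \<le> card (Pow b)"
      using Cons.prems by (intro card_mono) (auto simp: nsets_def)
    also have "\<dots> \<le> 2 ^ v" using Cons.prems by (simp add: card_Pow)
    finally have "(card b choose Suc j) * card (picks j Bs) \<le> 2 ^ v * (1 + 2 ^ v) ^ length Bs"
      using Cons by (intro mult_mono) auto
    moreover have "card (picks k (b # Bs)) \<le>
        card (picks (Suc j) Bs) + (card b choose Suc j) * card (picks j Bs)"
      unfolding Suc using Cons.prems by (intro card_picks_Cons) blast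
    moreover have "card (picks (Suc j) Bs) \<le> (1 + 2 ^ v) ^ length Bs"
      using Cons by auto
    ultimately show ?thesis by (simp add: algebra_simps)
  qed (simp del: power_Suc)
qed

text \<open>Thinning by Ramsey's theorem spoils exact level sizes, so only lower bounds are tracked;
  \<open>staircase_in_large\<close> restores a staircase at the end.\<close>

definition large :: "nat \<Rightarrow> nat \<Rightarrow> 'a set list \<Rightarrow> bool" where
  "large w u Cs \<longleftrightarrow> w \<le> length Cs \<and> (\<forall>C\<in>set Cs. finite C \<and> u \<le> card C)"

lemma list_emb_map_filter:
  "(\<And>C. C \<in> set Cs \<Longrightarrow> D C \<subseteq> C) \<Longrightarrow> list_emb (\<subseteq>) (map D (filter P Cs)) Cs"
  by (induction Cs) auto

text \<open>Ramsey's theorem inside each level gives one colour per level; by pigeonhole half of the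
  levels share it.\<close>

lemma homogenize_one:
  fixes c :: "'a set \<Rightarrow> bool"
  assumes "large (2 * w) (ramsey_number u k) Cs"
  obtains Cs' b where "list_emb (\<subseteq>) Cs' Cs" "large w u Cs'"
    "\<And>C t. C \<in> set Cs' \<Longrightarrow> t \<in> [C]\<^bsup>k\<^esup> \<Longrightarrow> c t = b"
proof -
  have "\<forall>C\<in>set Cs. \<exists>D b. D \<subseteq> C \<and> card D = u \<and> finite D \<and> (\<forall>t\<in>[D]\<^bsup>k\<^esup>. c t = b)"
  proof
    fix C assume "C \<in> set Cs"
    then have "ramsey_number u k \<le> card C" "finite C"
      using assms by (auto simp: large_def)
    then show "\<exists>D b. D \<subseteq> C \<and> card D = u \<and> finite D \<and> (\<forall>t\<in>[D]\<^bsup>k\<^esup>. c t = b)"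
      by (rule ramsey_number_homogeneous[where c = c]) (intro exI conjI ballI)
  qed
  then obtain D \<beta> where D\<beta>: "\<forall>C\<in>set Cs. D C \<subseteq> C \<and> card (D C) = u \<and> finite (D C) \<and>
      (\<forall>t\<in>[D C]\<^bsup>k\<^esup>. c t = \<beta> C)"
    unfolding bchoice_iff by (elim exE) (rule that)
  then have D: "\<And>C. C \<in> set Cs \<Longrightarrow> D C \<subseteq> C \<and> card (D C) = u \<and> finite (D C)"
    by simp
  have "length (filter \<beta> Cs) + length (filter (\<lambda>C. \<not> \<beta> C) Cs) = length Cs"
    by (rule sum_length_filter_compl)
  moreover have "2 * w \<le> length Cs" using assms by (simp add: large_def)
  ultimately have "w \<le> length (filter (\<lambda>C. \<beta> C = True) Cs) \<or>
      w \<le> length (filter (\<lambda>C. \<beta> C = False) Cs)"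
    by auto
  then obtain b where b: "w \<le> length (filter (\<lambda>C. \<beta> C = b) Cs)" by blast
  show thesis
  proof
    show "list_emb (\<subseteq>) (map D (filter (\<lambda>C. \<beta> C = b) Cs)) Cs"
      using D by (intro list_emb_map_filter) auto
    show "large w u (map D (filter (\<lambda>C. \<beta> C = b) Cs))"
      using b D by (auto simp: large_def)
    show "c t = b" if "C \<in> set (map D (filter (\<lambda>C. \<beta> C = b) Cs))" "t \<in> [C]\<^bsup>k\<^esup>" for C t
      using that D\<beta> by auto
  qed
qed

lemma nsets_list_emb:
  assumes "list_emb (\<subseteq>) Cs' Cs" "C \<in> set Cs'" "t \<in> [C]\<^bsup>k\<^esup>"
  obtains C' where "C' \<in> set Cs" "t \<in> [C']\<^bsup>k\<^esup>"
proof -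
  obtain C' where "C' \<in> set Cs" "C \<subseteq> C'"
    using list_emb_set[OF assms(1,2)] .
  then show thesis using that[of C'] assms(3) nsets_mono[of C C' k] by blast
qed

text \<open>Iterates \<open>homogenize_one\<close> over \<open>S\<close>: each \<open>s\<close>
  costs one Ramsey number in the level sizes and a factor 2 in the number of levels.\<close>

lemma homogenize:
  fixes c :: "'b \<Rightarrow> 'a set \<Rightarrow> bool"
  assumes "finite S" "card S \<le> q" "large (2 ^ q * w) (ramsey_iter q u k) Cs"
  shows "\<exists>Cs' \<tau>. list_emb (\<subseteq>) Cs' Cs \<and> large w u Cs' \<and>
    (\<forall>s\<in>S. \<forall>C\<in>set Cs'. \<forall>t\<in>[C]\<^bsup>k\<^esup>. c s t = \<tau> s)"
  using assms
proof (induction q arbitrary: S Cs)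
  case 0
  then have "S = {}" by simp
  then show ?case using 0 by (auto intro!: exI[of _ Cs] list_emb_refl)
next
  case (Suc q)
  obtain x S' where S': "finite S'" "card S' \<le> q" "S \<subseteq> insert x S'"
  proof (cases "S = {}")
    case False
    then obtain x where "x \<in> S" by blast
    then show ?thesis using that[of "S - {x}" x] Suc.prems(1,2) by (simp add: insert_absorb)
  qed (use that[of "{}"] in auto)
  have lg: "large (2 * (2 ^ q * w)) (ramsey_number (ramsey_iter q u k) k) Cs"
    using Suc.prems(3) by (simp add: mult.assoc)
  obtain Ds b where Ds: "list_emb (\<subseteq>) Ds Cs" "large (2 ^ q * w) (ramsey_iter q u k) Ds"
    and b: "\<And>C t. C \<in> set Ds \<Longrightarrow> t \<in> [C]\<^bsup>k\<^esup> \<Longrightarrow> c x t = b"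
    by (rule homogenize_one[OF lg, where c = "c x"]) (rule that)
  have "\<exists>Cs' \<tau>. list_emb (\<subseteq>) Cs' Ds \<and> large w u Cs' \<and>
      (\<forall>s\<in>S'. \<forall>C\<in>set Cs'. \<forall>t\<in>[C]\<^bsup>k\<^esup>. c s t = \<tau> s)"
    using S'(1,2) Ds(2) by (rule Suc.IH)
  then obtain Cs' \<tau> where H: "list_emb (\<subseteq>) Cs' Ds \<and> large w u Cs' \<and>
      (\<forall>s\<in>S'. \<forall>C\<in>set Cs'. \<forall>t\<in>[C]\<^bsup>k\<^esup>. c s t = \<tau> s)"
    by (elim exE) (rule that)
  then have Cs': "list_emb (\<subseteq>) Cs' Ds" "large w u Cs'" by auto
  have "c s t = (\<tau>(x := b)) s" if s: "s \<in> S" and C: "C \<in> set Cs'" and t: "t \<in> [C]\<^bsup>k\<^esup>" for s C t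
  proof (cases "s = x")
    case True
    then show ?thesis using nsets_list_emb[OF Cs'(1) C t] b by auto
  next
    case False
    then have "s \<in> S'" using s S'(3) by blast
    then show ?thesis using False H C t by simp
  qed
  moreover have "list_emb (\<subseteq>) Cs' Cs"
    using Cs'(1) Ds(1) by (rule list_emb_subset_trans)
  ultimately show ?case
    using Cs'(2) by (intro exI[of _ Cs'] exI[of _ "\<tau>(x := b)"] conjI ballI)
qed

text \<open>
  As lists start with the top level, \<open>\<tau>\<close> gives the colour of a pick in terms of all its levels but
  the top one.
\<close>
definition tail_determined ::
  "nat \<Rightarrow> ('a set list \<Rightarrow> bool) \<Rightarrow> ('a set list \<Rightarrow> bool) \<Rightarrow> 'a set list \<Rightarrow> 'a set list \<Rightarrow> bool" where
  "tail_determined k c \<tau> As Cs \<longleftrightarrow>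
     (\<forall>C\<in>set Cs. \<forall>t s. t # s \<in> picks (Suc k) (C # As) \<longrightarrow> c (t # s) = \<tau> s)"

text \<open>The bottom part \<open>As\<close> grows one level at a time. The lowest candidate is cut
  down to \<open>v\<close> points and joins \<open>As\<close>; the candidates above it are thinned
  until the colour no longer depends on the top set. Since levels of \<open>As\<close> have exactly
  \<open>v\<close> points, the number of tails is bounded in advance, so \<open>w'\<close> and
  \<open>u'\<close> can be chosen before the colouring.\<close>

lemma end_homogeneous:
  fixes v k :: nat
  shows "\<exists>w' u'. \<forall>Cs (c :: 'a set list \<Rightarrow> bool). large w' u' Cs \<longrightarrow>
    (\<exists>As Cs' \<tau>. list_emb (\<subseteq>) (Cs' @ As) Cs \<and> length As = a \<and>
       (\<forall>A\<in>set As. finite A \<and> card A = v) \<and> large w u Cs' \<and>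
       tail_determined k c \<tau> As Cs')"
proof (induction a arbitrary: w u)
  case 0
  \<comment> \<open>With no levels in \<open>As\<close> the empty list is the only possible
    tail.\<close>
  define q where "q = (1::nat)"
  have *: "\<exists>As Cs' \<tau>. list_emb (\<subseteq>) (Cs' @ As) Cs \<and> length As = 0 \<and>
       (\<forall>A\<in>set As. finite A \<and> card A = v) \<and> large w u Cs' \<and>
       tail_determined k c \<tau> As Cs'"
    if Cs: "large (2 ^ q * w) (ramsey_iter q u (Suc k)) Cs"
    for Cs and c :: "'a set list \<Rightarrow> bool"
  proof -
    have "finite (picks k ([] :: 'a set list))" by (rule finite_picks) simp
    moreover have "card (picks k ([] :: 'a set list)) \<le> q"
      using card_picks_le_power[of "[] :: 'a set list"] by (simp add: q_def)
    ultimately have "\<exists>Cs' \<tau>. list_emb (\<subseteq>) Cs' Cs \<and> large w u Cs' \<and>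
        (\<forall>s\<in>picks k []. \<forall>C\<in>set Cs'. \<forall>t\<in>[C]\<^bsup>Suc k\<^esup>. c (t # s) = \<tau> s)"
      by (rule homogenize) (rule Cs)
    then obtain Cs' \<tau> where "list_emb (\<subseteq>) Cs' Cs \<and> large w u Cs' \<and>
        (\<forall>s\<in>picks k []. \<forall>C\<in>set Cs'. \<forall>t\<in>[C]\<^bsup>Suc k\<^esup>. c (t # s) = \<tau> s)"
      by (elim exE) (rule that)
    then show ?thesis
      by (intro exI[of _ "[]"] exI[of _ Cs'] exI[of _ \<tau>])
        (auto simp: tail_determined_def elim!: picks_ConsE)
  qed
  show ?case
    by (rule exI, rule exI, intro allI impI, rule *)
next
  case (Suc a)
  \<comment> \<open>\<open>q\<close> bounds the number of tails in the \<open>Suc a\<close> levels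
    \<open>D # As\<close>. The number \<open>u1\<close> leaves room both for \<open>D\<close> inside
    \<open>C0\<close> and for \<open>q\<close> rounds of thinning; the extra candidate in
    \<open>Suc (2 ^ q * w)\<close> becomes \<open>C0\<close>.\<close>
  define q where "q = (1 + 2 ^ v :: nat) ^ Suc a"
  define u1 where "u1 = max v (ramsey_iter q u (Suc k))"
  obtain w' u' where step: "\<forall>Cs (c :: 'a set list \<Rightarrow> bool). large w' u' Cs \<longrightarrow>
      (\<exists>As Cs' \<tau>. list_emb (\<subseteq>) (Cs' @ As) Cs \<and> length As = a \<and>
       (\<forall>A\<in>set As. finite A \<and> card A = v) \<and> large (Suc (2 ^ q * w)) u1 Cs' \<and>
       tail_determined k c \<tau> As Cs')"
    using Suc.IH[of "Suc (2 ^ q * w)" u1] by (elim exE) (rule that)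
  have *: "\<exists>As Cs' \<tau>. list_emb (\<subseteq>) (Cs' @ As) Cs \<and> length As = Suc a \<and>
       (\<forall>A\<in>set As. finite A \<and> card A = v) \<and> large w u Cs' \<and>
       tail_determined k c \<tau> As Cs'"
    if Cs: "large w' u' Cs" for Cs and c :: "'a set list \<Rightarrow> bool"
  proof -
    obtain As Cs1 \<tau> where emb1: "list_emb (\<subseteq>) (Cs1 @ As) Cs"
      and As: "length As = a" "\<forall>A\<in>set As. finite A \<and> card A = v"
      and Cs1: "large (Suc (2 ^ q * w)) u1 Cs1" and "tail_determined k c \<tau> As Cs1"
      using step[rule_format, OF Cs, of c] by (elim exE conjE) (rule that)
    then have \<tau>: "c (t # s) = \<tau> s" if "C \<in> set Cs1" "t # s \<in> picks (Suc k) (C # As)" for C t s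
      using that by (simp add: tail_determined_def)
    obtain Cs2 C0 where Cs1_eq: "Cs1 = Cs2 @ [C0]"
      using Cs1 by (cases Cs1 rule: rev_cases) (auto simp: large_def)
    have Cs2: "large (2 ^ q * w) (ramsey_iter q u (Suc k)) Cs2" and "v \<le> card C0"
      using Cs1 by (auto simp: large_def Cs1_eq u1_def)
    then obtain D where D: "D \<subseteq> C0" "card D = v" "finite D"
      by (metis obtain_subset_with_card_n)
    have fin: "finite (picks k (D # As))"
      by (rule finite_picks) (use As D in auto)
    have card: "card (picks k (D # As)) \<le> q"
      using card_picks_le_power[of "D # As" v k] As D unfolding q_def
      by (metis length_Cons order_refl set_ConsD)
    have "\<exists>Cs' \<tau>. list_emb (\<subseteq>) Cs' Cs2 \<and> large w u Cs' \<and>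
        (\<forall>s\<in>picks k (D # As). \<forall>C\<in>set Cs'. \<forall>t\<in>[C]\<^bsup>Suc k\<^esup>. c (t # s) = \<tau> s)"
      using fin card Cs2 by (rule homogenize)
    then obtain Cs3 \<tau>' where H: "list_emb (\<subseteq>) Cs3 Cs2 \<and> large w u Cs3 \<and>
        (\<forall>s\<in>picks k (D # As). \<forall>C\<in>set Cs3. \<forall>t\<in>[C]\<^bsup>Suc k\<^esup>. c (t # s) = \<tau>' s)"
      by (elim exE) (rule that)
    then have emb3: "list_emb (\<subseteq>) Cs3 Cs2" and Cs3: "large w u Cs3" by auto
    from H have \<tau>': "c (t # s) = \<tau>' s"
      if "s \<in> picks k (D # As)" "C \<in> set Cs3" "t \<in> [C]\<^bsup>Suc k\<^esup>" for s C t
      using that by simp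
    \<comment> \<open>On tails inside \<open>As\<close> the old \<tau> takes precedence, because the
      top set may then come from \<open>D\<close> or \<open>As\<close>, where \<tau>' says nothing.
      Tails using \<open>D\<close> force the top set into \<open>C\<close>, where \<tau>'
      applies.\<close>
    define \<sigma> where "\<sigma> s = (if s \<in> picks k As then \<tau> s else \<tau>' s)" for s
    have det: "c (t # s) = \<sigma> s"
      if C: "C \<in> set Cs3" and ts: "t # s \<in> picks (Suc k) (C # D # As)" for C t s
      using ts
    proof (cases rule: picks_ConsE)
      case 1
      then have "s \<in> picks k As"
        by (cases rule: picks_ConsE) (simp_all add: picks_tail)
      moreover have "picks (Suc k) (D # As) \<subseteq> picks (Suc k) (C0 # As)"
        by (rule picks_mono) (simp add: D(1) list_emb_refl)
      with 1 have "t # s \<in> picks (Suc k) (C0 # As)" ..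
      ultimately show ?thesis using \<tau>[of C0] by (simp add: \<sigma>_def Cs1_eq)
    next
      case 2
      obtain C' where "C' \<in> set Cs2" "t \<in> [C']\<^bsup>Suc k\<^esup>"
        using nsets_list_emb[OF emb3 C 2(1)] .
      then have "c (t # s) = \<tau> s" if "s \<in> picks k As"
        using that by (intro \<tau>[of C']) (auto simp: Cs1_eq picks_Suc_Cons)
      then show ?thesis
        using \<tau>'[OF 2(2) C 2(1)] by (simp add: \<sigma>_def)
    qed
    have "list_emb (\<subseteq>) (D # As) (C0 # As)"
      by (simp add: D(1) list_emb_refl)
    then have "list_emb (\<subseteq>) (Cs3 @ D # As) (Cs1 @ As)"
      using list_emb_append_mono[OF emb3] by (simp add: Cs1_eq)
    then have "list_emb (\<subseteq>) (Cs3 @ D # As) Cs"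
      using emb1 by (rule list_emb_subset_trans)
    then show ?thesis
      using Cs3 As D det
      by (intro exI[of _ "D # As"] exI[of _ Cs3] exI[of _ \<sigma>]) (auto simp: tail_determined_def)
  qed
  show ?case
    by (rule exI, rule exI, intro allI impI, rule *)
qed

lemma staircase_in_large:
  assumes "\<And>A. A \<in> set As \<Longrightarrow> finite A \<and> length As \<le> card A"
  shows "\<exists>Bs. staircase (length As) Bs \<and> list_emb (\<subseteq>) Bs As"
  using assms
proof (induction As)
  case (Cons A As)
  have "finite A' \<and> length As \<le> card A'" if "A' \<in> set As" for A'
    using Cons.prems[of A'] that by simp
  then obtain Bs where "staircase (length As) Bs" "list_emb (\<subseteq>) Bs As"
    using Cons.IH by blast
  moreover have "Suc (length As) \<le> card A"
    using Cons.prems[of A] by simp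
  then obtain B where "B \<subseteq> A" "card B = Suc (length As)"
    by (rule obtain_subset_with_card_n)
  ultimately show ?case
    by (intro exI[of _ "B # Bs"]) (auto simp: staircase_Cons)
qed simp

text \<open>Picks lying entirely in \<open>As\<close> are also picks of \<open>C # As\<close>, so
  their colour is \<tau> of their tail. Applying the induction hypothesis to \<tau> inside
  \<open>As\<close> therefore makes the picks of height \<open>Suc k\<close> homogeneous.\<close>

theorem ramsey_staircase:
  "\<exists>m\<ge>n. \<forall>Bs (c :: 'a set list \<Rightarrow> bool). staircase m Bs \<longrightarrow>
     (\<exists>Zs\<in>picks n Bs. \<exists>b. \<forall>Xs\<in>picks k Zs. c Xs = b)"
proof (induction k)
  case 0
  have "\<exists>Zs\<in>picks n Bs. \<exists>b. \<forall>Xs\<in>picks 0 Zs. c Xs = b" if "staircase n Bs"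
    for Bs and c :: "'a set list \<Rightarrow> bool"
    using that
    by (intro bexI[of _ Bs] exI[of _ "c []"]) (auto simp: picks_def intro: list_emb_refl)
  then show ?case by (intro exI[of _ n] conjI allI impI order_refl)
next
  case (Suc k)
  then obtain m where m: "\<forall>Bs (c :: 'a set list \<Rightarrow> bool). staircase m Bs \<longrightarrow>
     (\<exists>Zs\<in>picks n Bs. \<exists>b. \<forall>Xs\<in>picks k Zs. c Xs = b)"
    by (elim exE conjE) (rule that)
  \<comment> \<open>\<open>m\<close> levels of \<open>m\<close> points contain a staircase of height
    \<open>m\<close>. The parameters 1 and 0 keep one candidate \<open>C\<close>, so that
    \<open>tail_determined\<close> is not vacuous.\<close>
  obtain w u where wu: "\<forall>Cs (c :: 'a set list \<Rightarrow> bool). large w u Cs \<longrightarrow>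
    (\<exists>As Cs' \<tau>. list_emb (\<subseteq>) (Cs' @ As) Cs \<and> length As = m \<and>
       (\<forall>A\<in>set As. finite A \<and> card A = m) \<and> large 1 0 Cs' \<and>
       tail_determined k c \<tau> As Cs')"
    using end_homogeneous[where a = m and w = 1 and u = 0 and v = m and k = k] by (elim exE) (rule that)
  have "\<exists>Zs\<in>picks n Bs. \<exists>b. \<forall>Xs\<in>picks (Suc k) Zs. c Xs = b"
    if Bs: "staircase (n + w + u) Bs" for Bs and c :: "'a set list \<Rightarrow> bool"
  proof -
    \<comment> \<open>The top \<open>w\<close> levels of a staircase of height
      \<open>n + w + u\<close> have more than \<open>n + u\<close> points each.\<close>
    have lg: "large w u (take w Bs)"
      using Bs staircase_length[OF Bs]
      by (auto simp: large_def dest: staircase_take_card staircase_mem in_set_takeD)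
    obtain As Cs' \<tau> where emb: "list_emb (\<subseteq>) (Cs' @ As) (take w Bs)"
      and As: "length As = m" "\<forall>A\<in>set As. finite A \<and> card A = m" and "large 1 0 Cs'"
      and "tail_determined k c \<tau> As Cs'"
      using wu[rule_format, OF lg, of c] by (elim exE conjE) (rule that)
    then obtain C where \<tau>: "\<And>t s. t # s \<in> picks (Suc k) (C # As) \<Longrightarrow> c (t # s) = \<tau> s"
      by (cases Cs') (auto simp: large_def tail_determined_def)
    obtain Bs' where Bs': "staircase m Bs'" "list_emb (\<subseteq>) Bs' As"
      using staircase_in_large[of As] As by auto
    obtain Zs b where Zs: "Zs \<in> picks n Bs'" and b: "\<And>s. s \<in> picks k Zs \<Longrightarrow> \<tau> s = b"
      using m[rule_format, OF Bs'(1), of \<tau>] by (elim bexE exE) (rule that, assumption, erule (1) bspec)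
    have Zs_As: "list_emb (\<subseteq>) Zs As"
      using Zs Bs' list_emb_subset_trans by (auto simp: picks_def)
    have "list_emb (\<subseteq>) As Bs"
      using emb list_emb_append2[of "(\<subseteq>)" As As Cs'] list_emb_prefix[of "(\<subseteq>)" _ "take w Bs" "drop w Bs"]
        list_emb_subset_trans by (metis append_take_drop_id list_emb_refl subset_refl)
    then have "Zs \<in> picks n Bs"
      using Zs Zs_As list_emb_subset_trans by (auto simp: picks_def)
    moreover have "c Xs = b" if Xs: "Xs \<in> picks (Suc k) Zs" for Xs
    proof -
      obtain t s where ts: "Xs = t # s"
        using Xs by (cases Xs) (auto simp: picks_def)
      have "t # s \<in> picks (Suc k) (C # As)"
        using Xs Zs_As picks_mono[of Zs "C # As"] by (auto simp: ts)
      then show ?thesis using \<tau> b picks_tail Xs ts by metis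
    qed
    ultimately show ?thesis by (intro bexI[of _ Zs] exI[of _ b] ballI)
  qed
  then show ?case
    by (intro exI[of _ "n + w + u"] conjI allI impI) simp
qed

subsection \<open>Triangles as staircases\<close>

lemma strict_mono_triangle: "strict_mono triangle"
  by (simp add: strict_mono_Suc_iff)

text \<open>Together with \<open>staircase\<close> this characterizes the level lists of
  triangles.\<close>

definition descending :: "nat set list \<Rightarrow> bool" where
  "descending Xs \<longleftrightarrow> sorted_wrt (\<lambda>A B. \<forall>a\<in>A. \<forall>b\<in>B. b < a) Xs"

lemma descending_Nil [simp]: "descending []"
  by (simp add: descending_def)

lemma descending_Cons:
  "descending (T # Xs) \<longleftrightarrow> (\<forall>t\<in>T. \<forall>u\<in>\<Union>(set Xs). u < t) \<and> descending Xs"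
  by (auto simp: descending_def)

lemma descending_drop: "descending Xs \<Longrightarrow> descending (drop i Xs)"
  by (simp add: descending_def sorted_wrt_drop)

lemma descending_list_emb:
  "list_emb (\<subseteq>) Xs Bs \<Longrightarrow> descending Bs \<Longrightarrow> descending Xs"
proof (induction rule: list_emb.induct)
  case (list_emb_Cons2 x y xs ys)
  have "\<Union>(set xs) \<subseteq> \<Union>(set ys)"
    using list_emb_set[OF list_emb_Cons2(2)] by blast
  then show ?case using list_emb_Cons2 by (auto simp: descending_Cons) blast
qed (auto simp: descending_Cons)

definition level_list :: "nat \<Rightarrow> nat set \<Rightarrow> nat set list" where
  "level_list k X = rev (map (level X) [1..<Suc k])"

lemma level_list_0 [simp]: "level_list 0 X = []"
  by (simp add: level_list_def)

lemma level_list_Suc [simp]: "level_list (Suc k) X = level X (Suc k) # level_list k X"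
  by (simp add: level_list_def)

lemma level_list_cong:
  "(\<And>i. 1 \<le> i \<Longrightarrow> i \<le> k \<Longrightarrow> level X i = level Y i) \<Longrightarrow> level_list k X = level_list k Y"
  by (auto simp: level_list_def)

lemma image_nth_append: "(!) (xs @ ys) ` {length xs..<length xs + length ys} = set ys"
proof -
  have "{length xs..<length xs + length ys} = (+) (length xs) ` {..<length ys}"
    by (simp add: lessThan_atLeast0 add.commute)
  then show ?thesis by (simp add: image_image set_conv_nth) auto
qed

text \<open>The top level \<open>T\<close> lies above the union \<open>U\<close> of the others, so
  the sorted list of \<open>T \<union> U\<close> is that of \<open>U\<close> followed by that of
  \<open>T\<close>: positions from \<open>triangle j\<close> on give \<open>T\<close>, earlier ones
  the levels of \<open>U\<close>.\<close>

lemma Union_staircase: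
  "staircase k Xs \<Longrightarrow> descending Xs \<Longrightarrow>
     \<Union>(set Xs) \<in> triangles k \<and> level_list k (\<Union>(set Xs)) = Xs"
proof (induction Xs arbitrary: k)
  case Nil
  then show ?case by (simp add: triangles_def)
next
  case (Cons T Xs)
  then obtain j where k: "k = Suc j" and T: "card T = Suc j" and Xs: "staircase j Xs"
    by (cases k) (auto simp: staircase_Cons)
  define U where "U = \<Union>(set Xs)"
  have U: "finite U" "card U = triangle j" "level_list j U = Xs"
    using Cons.IH[OF Xs] Cons.prems(2) by (auto simp: U_def triangles_def descending_Cons)
  have fT: "finite T" using T by (simp add: card_ge_0_finite)
  have less: "u < t" if "u \<in> U" "t \<in> T" for u t
    using that Cons.prems(2) by (auto simp: U_def descending_Cons)
  have "U \<inter> T = {}" using less by blast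
  then have card: "card (T \<union> U) = triangle k"
    using U T fT by (subst card_Un_disjoint) (auto simp: k)
  have sl: "sorted_list_of_set (T \<union> U) = sorted_list_of_set U @ sorted_list_of_set T"
    using U fT less \<open>U \<inter> T = {}\<close>
    by (intro sorted_distinct_set_unique) (auto simp: sorted_append intro: less_imp_le)
  have len: "length (sorted_list_of_set U) = triangle j" "length (sorted_list_of_set T) = Suc j"
    using U T by simp_all
  have "level (T \<union> U) (Suc j) = T"
    using image_nth_append[of "sorted_list_of_set U" "sorted_list_of_set T"] fT len
    by (simp add: level_def sl del: length_sorted_list_of_set)
  moreover have "level (T \<union> U) i = level U i" if "i \<le> j" for i
  proof -
    have "triangle i \<le> triangle j"
      using that strict_mono_triangle by (simp add: strict_mono_less_eq)
    then show ?thesis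
      unfolding level_def sl using len by (intro image_cong) (auto simp: nth_append)
  qed
  then have "level_list j (T \<union> U) = Xs"
    using U(3) by (metis level_list_cong)
  ultimately show ?case
    using card U(1) fT by (simp add: k U_def[symmetric] triangles_def)
qed

text \<open>Cutting the sorted enumeration after \<open>triangle k\<close> entries leaves a triangle
  of height \<open>k\<close> and the top level.\<close>

lemma ex_staircase:
  "X \<in> triangles k \<Longrightarrow> \<exists>Xs. staircase k Xs \<and> descending Xs \<and> \<Union>(set Xs) = X"
proof (induction k arbitrary: X)
  case 0
  then show ?case by (intro exI[of _ "[]"]) (auto simp: triangles_def)
next
  case (Suc k)
  define xs where "xs = sorted_list_of_set X"
  define U where "U = set (take (triangle k) xs)"
  define T where "T = set (drop (triangle k) xs)"
  have X: "finite X" "card X = triangle k + Suc k"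
    using Suc.prems by (simp_all add: triangles_def)
  then have len: "length xs = triangle k + Suc k" and dist: "distinct xs" "sorted xs"
    and set: "set xs = X"
    by (simp_all add: xs_def)
  have UT: "U \<union> T = X"
    unfolding U_def T_def set[symmetric] by (metis append_take_drop_id set_append)
  have "card U = triangle k" "card T = Suc k"
    unfolding U_def T_def using dist len by (simp_all add: distinct_card)
  moreover have "finite U" by (simp add: U_def)
  ultimately obtain Xs where Xs: "staircase k Xs" "descending Xs" "\<Union>(set Xs) = U"
    using Suc.IH[of U] by (auto simp: triangles_def)
  have "sorted_wrt (<) (take (triangle k) xs @ drop (triangle k) xs)"
    using dist by (simp add: strict_sorted_iff)
  then have "\<forall>t\<in>T. \<forall>u\<in>U. u < t"
    unfolding sorted_wrt_append U_def T_def by blast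
  then show ?case
    using Xs \<open>card T = Suc k\<close> UT
    by (intro exI[of _ "T # Xs"]) (auto simp: staircase_Cons descending_Cons)
qed

lemma level_list_props:
  assumes "X \<in> triangles k"
  shows "staircase k (level_list k X)" "descending (level_list k X)"
    "\<Union>(set (level_list k X)) = X"
  using ex_staircase[OF assms] Union_staircase by metis+

lemma levels_eq: "X \<in> triangles k \<Longrightarrow> levels X = set (level_list k X)"
  using strict_mono_less_eq[OF strict_mono_triangle]
  by (auto simp: levels_def triangles_def level_list_def)

section \<open>Injections between levels versus order embeddings of level lists\<close>

lemma list_emb_imp_inj:
  "list_emb (\<subseteq>) Xs Bs \<Longrightarrow> distinct Bs \<Longrightarrow>
     \<exists>f. inj_on f (set Xs) \<and> (\<forall>L\<in>set Xs. f L \<in> set Bs \<and> L \<subseteq> f L)"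
proof (induction rule: list_emb.induct)
  case (list_emb_Cons2 x b xs bs)
  then obtain f where f: "inj_on f (set xs)" "\<And>L. L \<in> set xs \<Longrightarrow> f L \<in> set bs \<and> L \<subseteq> f L"
    by auto
  then show ?case
    using list_emb_Cons2
    by (intro exI[of _ "f(x := b)"]) (auto simp: inj_on_def)
next
  case (list_emb_Cons xs ys y)
  then show ?case by auto
qed auto

text \<open>The injection in the game's relation is not assumed monotone, but nonempty separated
  levels force it to preserve the order.\<close>

lemma inj_imp_list_emb:
  assumes "descending Xs" "descending Bs" "\<And>X. X \<in> set Xs \<Longrightarrow> X \<noteq> {}"
    "inj_on f (set Xs)" "\<And>L. L \<in> set Xs \<Longrightarrow> f L \<in> set Bs \<and> L \<subseteq> f L"
  shows "list_emb (\<subseteq>) Xs Bs"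
  using assms
proof (induction Bs arbitrary: Xs)
  case Nil
  then show ?case by (cases Xs) auto
next
  case (Cons b bs)
  show ?case
  proof (cases Xs)
    case (Cons x xs)
    note [simp] = \<open>Xs = x # xs\<close>
    have x: "x \<noteq> {}" "x \<notin> set xs"
      using Cons.prems(1,3) by (auto simp: descending_Cons)
    show ?thesis
    proof (cases "f x = b")
      case True
      have "f L \<noteq> b" if "L \<in> set xs" for L
        using that True x Cons.prems(4) by auto
      then have "list_emb (\<subseteq>) xs bs"
        using Cons.prems by (intro Cons.IH) (auto simp: descending_Cons)
      then show ?thesis using True Cons.prems(5)[of x] by auto
    next
      case False
      \<comment> \<open>If a level \<open>L\<close> below \<open>x\<close> went to the top level
        \<open>b\<close> while \<open>x\<close> went lower, the points of \<open>L\<close> would lie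
        both below and above those of \<open>x\<close>.\<close>
      have "f L \<noteq> b" if L: "L \<in> set Xs" for L
      proof
        assume b: "f L = b"
        with False L have "L \<in> set xs" by auto
        moreover have "L \<subseteq> b" "x \<subseteq> \<Union>(set bs)"
          using Cons.prems(5)[OF L] Cons.prems(5)[of x] False b by auto
        moreover obtain l a where "l \<in> L" "a \<in> x"
          using Cons.prems(3)[OF L] x by auto
        ultimately have "l < a" "a < l"
          using Cons.prems(1,2) by (auto simp: descending_Cons) blast+
        then show False by simp
      qed
      then have "list_emb (\<subseteq>) Xs bs"
        using Cons.prems by (intro Cons.IH) (auto simp: descending_Cons)
      then show ?thesis by auto
    qed
  qed simp
qed

lemma distinct_descending:
  "descending Bs \<Longrightarrow> (\<And>B. B \<in> set Bs \<Longrightarrow> B \<noteq> {}) \<Longrightarrow> distinct Bs"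
  by (induction Bs) (auto simp: descending_Cons)

lemma tri_le_iff:
  assumes "X \<in> triangles k" "B \<in> triangles m"
  shows "X \<preceq>\<^sub>\<triangle> B \<longleftrightarrow> list_emb (\<subseteq>) (level_list k X) (level_list m B)"
proof
  note X = level_list_props[OF assms(1)] and B = level_list_props[OF assms(2)]
  assume "X \<preceq>\<^sub>\<triangle> B"
  then obtain f where "inj_on f (set (level_list k X))"
    "\<And>L. L \<in> set (level_list k X) \<Longrightarrow> f L \<in> set (level_list m B) \<and> L \<subseteq> f L"
    unfolding tri_le_def levels_eq[OF assms(1)] levels_eq[OF assms(2)] by blast
  then show "list_emb (\<subseteq>) (level_list k X) (level_list m B)"
    using X B staircase_mem[OF X(1)] by (intro inj_imp_list_emb) auto
next
  note X = level_list_props[OF assms(1)] and B = level_list_props[OF assms(2)]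
  assume emb: "list_emb (\<subseteq>) (level_list k X) (level_list m B)"
  have "X \<subseteq> B"
  proof
    fix x assume "x \<in> X"
    then obtain L where L: "L \<in> set (level_list k X)" "x \<in> L" using X(3) by blast
    obtain L' where "L' \<in> set (level_list m B)" "L \<subseteq> L'"
      using list_emb_set[OF emb L(1)] .
    then show "x \<in> B" using L(2) B(3) by blast
  qed
  moreover have "distinct (level_list m B)"
    using B staircase_mem[OF B(1)] by (intro distinct_descending) auto
  ultimately show "X \<preceq>\<^sub>\<triangle> B"
    unfolding tri_le_def levels_eq[OF assms(1)] levels_eq[OF assms(2)]
    using list_emb_imp_inj[OF emb] by blast
qed

lemma triangles_below_iff:
  assumes "B \<in> triangles m"
  shows "X \<in> triangles_below k B \<longleftrightarrow> X \<in> triangles k \<and> level_list k X \<in> picks k (level_list m B)"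
  using tri_le_iff[OF _ assms] level_list_props(1)
  by (auto simp: triangles_below_def picks_def)

lemma Union_picks:
  assumes "B \<in> triangles m" "Xs \<in> picks k (level_list m B)"
  shows "\<Union>(set Xs) \<in> triangles_below k B" "level_list k (\<Union>(set Xs)) = Xs"
proof -
  have "staircase k Xs" "descending Xs"
    using assms level_list_props(2)[OF assms(1)] descending_list_emb by (auto simp: picks_def)
  then have "\<Union>(set Xs) \<in> triangles k" "level_list k (\<Union>(set Xs)) = Xs"
    using Union_staircase by auto
  then show "\<Union>(set Xs) \<in> triangles_below k B" "level_list k (\<Union>(set Xs)) = Xs"
    using assms by (auto simp: triangles_below_iff)
qed

subsection \<open>The game on staircases\<close>

definition arrows :: "nat \<Rightarrow> nat \<Rightarrow> nat \<Rightarrow> bool" where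
  "arrows m n k \<longleftrightarrow> (\<forall>Bs (c :: nat set list \<Rightarrow> bool). staircase m Bs \<and> descending Bs \<longrightarrow>
     (\<exists>Zs\<in>picks n Bs. \<exists>b. \<forall>Xs\<in>picks k Zs. c Xs = b))"

lemma arrowsD:
  fixes c :: "nat set list \<Rightarrow> bool"
  assumes "arrows m n k" "staircase m Bs" "descending Bs"
  shows "\<exists>Zs\<in>picks n Bs. \<exists>b. \<forall>Xs\<in>picks k Zs. c Xs = b"
  using assms(1)[unfolded arrows_def, rule_format, OF conjI[OF assms(2,3)], of c] .

text \<open>A completed game is a 2-colouring of the level lists of subtriangles, the colour telling
  which player owns the subtriangle; with equal targets \<open>n\<close>, a win for either player is
  a homogeneous triangle.\<close>

lemma arrows_iff_no_draw:
  "arrows m n k \<longleftrightarrow> (\<forall>B X Y. completed_game m k B X Y \<longrightarrow> \<not> draw n n k B X Y)"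
proof (intro iffI allI impI)
  fix B X Y
  assume arr: "arrows m n k" and game: "completed_game m k B X Y"
  from game have B: "B \<in> triangles m" and XY: "X \<union> Y = triangles_below k B"
    by (auto simp: completed_game_def)
  have "\<exists>Zs\<in>picks n (level_list m B). \<exists>b. \<forall>Xs\<in>picks k Zs. (\<Union>(set Xs) \<in> X) = b"
    using arr level_list_props(1,2)[OF B] by (rule arrowsD)
  then obtain Zs b where Zs: "Zs \<in> picks n (level_list m B)"
    and b: "\<forall>Xs\<in>picks k Zs. (\<Union>(set Xs) \<in> X) = b"
    by (elim bexE exE) (rule that)
  define Z where "Z = \<Union>(set Zs)"
  have Z: "Z \<in> triangles_below n B" "level_list n Z = Zs"
    using Union_picks[OF B Zs] by (simp_all add: Z_def)
  then have Zn: "Z \<in> triangles n" by (simp add: triangles_below_def)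
  have below: "W \<in> X \<union> Y \<and> (W \<in> X) = b" if "W \<in> triangles_below k Z" for W
  proof -
    have W: "W \<in> triangles k" "level_list k W \<in> picks k Zs"
      using that by (simp_all add: triangles_below_iff[OF Zn] Z(2))
    moreover have "picks k Zs \<subseteq> picks k (level_list m B)"
      using Zs by (intro picks_mono) (simp add: picks_def)
    ultimately show ?thesis
      using bspec[OF b W(2)] level_list_props(3)[OF W(1)] XY
      by (auto simp: triangles_below_iff[OF B])
  qed
  then have "triangles_below k Z \<subseteq> X \<or> triangles_below k Z \<subseteq> Y"
    by (cases b) blast+
  then show "\<not> draw n n k B X Y"
    using Z(1) by (auto simp: draw_def player_wins_def)
next
  assume no_draw: "\<forall>B X Y. completed_game m k B X Y \<longrightarrow> \<not> draw n n k B X Y"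
  show "arrows m n k"
    unfolding arrows_def
  proof (intro allI impI, elim conjE)
    fix Bs and c :: "nat set list \<Rightarrow> bool"
    assume Bs: "staircase m Bs" "descending Bs"
    define B where "B = \<Union>(set Bs)"
    have B: "B \<in> triangles m" "level_list m B = Bs"
      using Union_staircase[OF Bs] by (auto simp: B_def)
    define X where "X = {W \<in> triangles_below k B. c (level_list k W)}"
    define Y where "Y = {W \<in> triangles_below k B. \<not> c (level_list k W)}"
    have "completed_game m k B X Y"
      using B by (auto simp: completed_game_def X_def Y_def)
    then have "\<not> draw n n k B X Y" using no_draw by simp
    then obtain Z where Z: "Z \<in> triangles_below n B"
      and "triangles_below k Z \<subseteq> X \<or> triangles_below k Z \<subseteq> Y"
      by (auto simp: draw_def player_wins_def)
    then obtain b where b: "\<And>W. W \<in> triangles_below k Z \<Longrightarrow> c (level_list k W) = b"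
      by (auto simp: X_def Y_def)
    have Z': "Z \<in> triangles n" "level_list n Z \<in> picks n Bs"
      using Z by (simp_all add: triangles_below_iff[OF B(1)] B(2))
    have "c Xs = b" if "Xs \<in> picks k (level_list n Z)" for Xs
      using Union_picks[OF Z'(1) that] b by metis
    with Z' show "\<exists>Zs\<in>picks n Bs. \<exists>b. \<forall>Xs\<in>picks k Zs. c Xs = b" by blast
  qed
qed

lemma mines_diag_eq: "mines_diag n k = (LEAST m. n \<le> m \<and> arrows m n k)"
  by (simp add: mines_diag_def mines_number_def arrows_iff_no_draw)

text \<open>\<open>ramsey_staircase\<close> supplies some such number, so the minimum is
  attained.\<close>

lemma mines_diag_arrows: "n \<le> mines_diag n k \<and> arrows (mines_diag n k) n k"
  unfolding mines_diag_eq
proof (rule LeastI_ex)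
  obtain m where "n \<le> m" and m: "\<forall>Bs (c :: nat set list \<Rightarrow> bool). staircase m Bs \<longrightarrow>
      (\<exists>Zs\<in>picks n Bs. \<exists>b. \<forall>Xs\<in>picks k Zs. c Xs = b)"
    using ramsey_staircase[of n k] by (elim exE conjE) (rule that)
  moreover have "arrows m n k"
    unfolding arrows_def by (intro allI impI, elim conjE) (rule m[rule_format])
  ultimately show "\<exists>m. n \<le> m \<and> arrows m n k" by blast
qed

theorem theorem8:
  fixes k :: nat
  assumes "2 \<le> k"
  shows "mines_diag (k + 1) k
           \<le> ramsey_iter (tri_binomial (mines_diag (k + 1) (k - 1)) (k - 1)) (k + 1) k"
proof -
  define j where "j = k - 1"
  have k: "k = Suc j" "1 \<le> j" using assms by (auto simp: j_def)
  define M where "M = mines_diag (k + 1) j"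
  define L where "L = tri_binomial M j"
  define N where "N = ramsey_iter L (k + 1) k"
  have M: "k + 1 \<le> M" and arr: "arrows M (k + 1) j"
    using mines_diag_arrows[of "k + 1" j] by (simp_all add: M_def)
  \<comment> \<open>From \<open>M < L + j\<close> and \<open>k = Suc j\<close> it follows that
    \<open>k + 1 + L\<close> exceeds \<open>M\<close>, so the top level of the big triangle is not
    among its \<open>M\<close> lowest ones.\<close>
  have "M - j < L"
    unfolding L_def using M k by (intro tri_binomial_ge) auto
  moreover have N_ge: "k + 1 + L \<le> N"
    unfolding N_def using k by (intro ramsey_iter_ge) auto
  ultimately have "M < N" using k by linarith
  have "arrows N (k + 1) k"
    unfolding arrows_def
  proof (intro allI impI, elim conjE)
    fix Bs and c :: "nat set list \<Rightarrow> bool"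
    assume Bs: "staircase N Bs" "descending Bs"
    then obtain b Cs where Bs_eq: "Bs = b # Cs" and b: "card b = N"
      using \<open>M < N\<close> by (cases Bs) (auto simp: staircase_Cons)
    define As where "As = drop (N - M) Bs"
    have As: "staircase M As" "descending As"
      using staircase_drop[OF Bs(1), of "N - M"] descending_drop[OF Bs(2)] \<open>M < N\<close>
      by (auto simp: As_def)
    have "As = drop (N - M - 1) Cs"
      using \<open>M < N\<close> by (simp add: As_def Bs_eq drop_Cons')
    then have "list_emb (\<subseteq>) As Cs"
      using list_emb_append2[of "(\<subseteq>)" As As "take (N - M - 1) Cs"]
      by (simp add: list_emb_refl)
    then have bAs: "list_emb (\<subseteq>) (b # As) Bs" by (simp add: Bs_eq)
    have fin: "finite (picks j As)" "finite b"
      using staircase_mem[OF As(1)] staircase_mem[OF Bs(1)]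
      by (auto simp: Bs_eq intro: finite_picks)
    have card: "card (picks j As) \<le> L"
      unfolding L_def using As(1) M k by (intro card_picks_le) auto
    have le: "ramsey_iter L (k + 1) k \<le> card b"
      by (simp add: b N_def)
    \<comment> \<open>There are at most \<open>L\<close> tails \<open>s\<close>, and
      \<open>b\<close> has \<open>N\<close> points, enough for \<open>L\<close> applications of
      Ramsey's theorem ending in \<open>k + 1\<close> points.\<close>
    obtain D \<tau> where D: "D \<subseteq> b" "card D = k + 1" "finite D"
      and \<tau>: "\<And>s t. s \<in> picks j As \<Longrightarrow> t \<in> [D]\<^bsup>k\<^esup> \<Longrightarrow> c (t # s) = \<tau> s"
      by (rule ramsey_iter_homogeneous[where c = "\<lambda>s t. c (t # s)", OF fin(1) card fin(2) le])
        (rule that)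
    have "\<exists>Zs\<in>picks (k + 1) As. \<exists>a. \<forall>s\<in>picks j Zs. \<tau> s = a"
      using arr As by (rule arrowsD)
    then obtain Zs a where Zs: "Zs \<in> picks (k + 1) As" and a: "\<forall>s\<in>picks j Zs. \<tau> s = a"
      by (elim bexE exE) (rule that)
    have Zs_As: "list_emb (\<subseteq>) Zs As" using Zs by (simp add: picks_def)
    show "\<exists>Zs\<in>picks (k + 1) Bs. \<exists>b. \<forall>Xs\<in>picks k Zs. c Xs = b"
    proof (cases "\<exists>Xs\<in>picks k Zs. c Xs = a")
      case True
      then obtain Xs where Xs: "list_emb (\<subseteq>) Xs Zs" "staircase k Xs" "c Xs = a"
        by (auto simp: picks_def)
      have "list_emb (\<subseteq>) (D # Xs) (b # As)"
        using list_emb_subset_trans[OF Xs(1) Zs_As] D(1) by simp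
      then have "D # Xs \<in> picks (k + 1) Bs"
        using list_emb_subset_trans[OF _ bAs] Xs(2) D(2) by (simp add: picks_def staircase_Cons)
      moreover have "c Ys = a" if Ys: "Ys \<in> picks k (D # Xs)" for Ys
      proof -
        \<comment> \<open>Either \<open>Ys\<close> avoids \<open>D\<close> and equals
          \<open>Xs\<close>, which has height \<open>k\<close> already, or its top lies in
          \<open>D\<close> and its colour is \<tau> of a tail below \<open>Zs\<close>.\<close>
        consider "Ys \<in> picks k Xs" | t s where "Ys = t # s" "t \<in> [D]\<^bsup>k\<^esup>" "s \<in> picks j Xs"
          using Ys unfolding k(1) picks_Suc_Cons by auto
        then show ?thesis
        proof cases
          case 1
          then show ?thesis using picks_eq_singleton[OF Xs(2)] Xs(3) by auto
        next
          case 2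
          have "s \<in> picks j Zs" using 2(3) picks_mono[OF Xs(1)] by blast
          then show ?thesis using \<tau>[OF _ 2(2)] a picks_mono[OF Zs_As] 2(1) by blast
        qed
      qed
      ultimately show ?thesis by blast
    next
      case False
      \<comment> \<open>No pick of height \<open>k\<close> in \<open>Zs\<close> has colour
        \<open>a\<close>, so all have colour \<open>\<not> a\<close>; it remains to place
        \<open>Zs\<close> below \<open>Bs\<close>.\<close>
      have "list_emb (\<subseteq>) As Bs"
        using \<open>list_emb (\<subseteq>) As Cs\<close> by (auto simp: Bs_eq)
      then have "Zs \<in> picks (k + 1) Bs"
        using Zs list_emb_subset_trans by (auto simp: picks_def)
      then show ?thesis using False by blast
    qed
  qed
  then have "k + 1 \<le> N \<and> arrows N (k + 1) k" using N_ge by simp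
  then have "mines_diag (k + 1) k \<le> N"
    unfolding mines_diag_eq by (rule Least_le)
  then show ?thesis by (simp add: N_def L_def M_def j_def)
qed

end
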